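(* Let $\sigma$ be a special $P$-morphism on $\mathcal A$, let $\mathbf t$ be an infinite word over $\mathcal A$ and $\mathbf s=\sigma(\mathbf t)$. Then $\mathbf s$ is almost rich if and only if $\mathbf t$ is almost rich.
   Context: For a finite word $w$, $D(w)=|w|+1-|\mathrm{PAL}(w)|$ with $\mathrm{PAL}(w)$ its set of distinct palindromic factors (including the empty word); an infinite word is almost rich if the defects of its factors are bounded. A standard $P$-morphism is a morphism $\varphi$ on $\mathcal A$ for which there is a palindrome $p$ (possibly empty) with $\varphi(x)=pq_x$ for all $x$, where each $q_x$ is a palindrome (possibly empty), or, when $p$ is non-empty, $q_x=\pi_x^{-1}$ with $\pi_x$ a proper palindromic suffix of $p$. It is special if (1) the words $\varphi(x)$ end with pairwise different letters, and (2) whenever $pq_xp$ occurs as a factor of some $\varphi(y_1\cdots y_n)p$, this occurrence is the occurrence of $\varphi(y_m)p$ starting right after $\varphi(y_1\cdots y_{m-1})$ for some $1\le m\le n$. A $P$-morphism is a morphism $\psi(x)=p''q_xp'$ ($x\in\mathcal A$) obtained from a standard $P$-morphism $\varphi(x)=pq_x$ and a factorization $p=p'p''$; it is special if the corresponding standard $P$-morphism $\varphi$ is special. *)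

theory Defs
  imports "HOL-Library.Sublist" "HOL-Library.Stream"
begin

definition palindrome :: "'a list \<Rightarrow> bool" where
  "palindrome w \<longleftrightarrow> rev w = w"

definition PAL :: "'a list \<Rightarrow> 'a list set" where
  "PAL w = {v. sublist v w \<and> palindrome v}"

definition defect :: "'a list \<Rightarrow> int" where
  "defect w = int (length w) + 1 - int (card (PAL w))"

definition factors :: "'a stream \<Rightarrow> 'a list set" where
  "factors s = {stake n (sdrop i s) | i n. True}"

definition almost_rich :: "'a stream \<Rightarrow> bool" where
  "almost_rich s \<longleftrightarrow> (\<exists>B. \<forall>w \<in> factors s. defect w \<le> B)"

text \<open>A morphism is given by its values on letters.\<close>

definition ext :: "('a \<Rightarrow> 'b list) \<Rightarrow> 'a list \<Rightarrow> 'b list" where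
  "ext f w = concat (map f w)"

text \<open>The library's \<^const>\<open>flat\<close> is infinite concatenation only for nonempty blocks; all letter
  images under a special P-morphism are nonempty.\<close>

definition ext_inf :: "('a \<Rightarrow> 'b list) \<Rightarrow> 'a stream \<Rightarrow> 'b stream" where
  "ext_inf f t = flat (smap f t)"

text \<open>The words \<open>q\<^sub>x\<close> are either ordinary words (\<open>Pos q\<close>) or formal inverses \<open>\<pi>\<^sup>-\<^sup>1\<close> (\<open>Neg \<pi>\<close>).
  \<open>sandwich u q v w\<close> says that \<open>u q v = w\<close> holds in the free group: a product
  \<open>u \<pi>\<^sup>-\<^sup>1 v\<close> is a word iff \<open>\<pi> = \<pi>\<^sub>1 \<pi>\<^sub>2\<close> where \<open>\<pi>\<^sub>2\<close> cancels a suffix of \<open>u\<close> and \<open>\<pi>\<^sub>1\<close> cancels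
  a prefix of \<open>v\<close>, and the word obtained is the same for every such factorization.\<close>

datatype 'a tail = Pos "'a list" | Neg "'a list"

fun sandwich :: "'a list \<Rightarrow> 'a tail \<Rightarrow> 'a list \<Rightarrow> 'a list \<Rightarrow> bool" where
  "sandwich u (Pos q) v w \<longleftrightarrow> w = u @ q @ v"
| "sandwich u (Neg \<pi>) v w \<longleftrightarrow>
     (\<exists>\<pi>1 \<pi>2 u' v'. \<pi> = \<pi>1 @ \<pi>2 \<and> u = u' @ \<pi>2 \<and> v = \<pi>1 @ v' \<and> w = u' @ v')"

text \<open>\<open>Neg\<close> is possible only for nonempty \<open>p\<close>, since \<open>[]\<close> has no strict suffix.\<close>

fun admissible_tail :: "'a list \<Rightarrow> 'a tail \<Rightarrow> bool" where
  "admissible_tail p (Pos q) \<longleftrightarrow> palindrome q"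
| "admissible_tail p (Neg \<pi>) \<longleftrightarrow> palindrome \<pi> \<and> strict_suffix \<pi> p"

definition standard_P_morphism ::
    "'a list \<Rightarrow> ('a \<Rightarrow> 'a tail) \<Rightarrow> ('a \<Rightarrow> 'a list) \<Rightarrow> bool" where
  "standard_P_morphism p q \<phi> \<longleftrightarrow>
     palindrome p \<and> (\<forall>x. admissible_tail p (q x) \<and> sandwich p (q x) [] (\<phi> x))"

text \<open>The word \<open>p q\<^sub>x p\<close> is \<open>\<phi> x @ p\<close>. An occurrence of it in \<open>\<phi>(y\<^sub>1\<dots>y\<^sub>n) p\<close> is a factorization
  \<open>u (p q\<^sub>x p) v\<close>; the index \<open>m\<close> below counts from 0.\<close>

definition special_standard_P_morphism ::
    "'a list \<Rightarrow> ('a \<Rightarrow> 'a tail) \<Rightarrow> ('a \<Rightarrow> 'a list) \<Rightarrow> bool" where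
  "special_standard_P_morphism p q \<phi> \<longleftrightarrow>
     standard_P_morphism p q \<phi> \<and>
     (\<forall>x. \<phi> x \<noteq> []) \<and>
     (\<forall>x y. x \<noteq> y \<longrightarrow> last (\<phi> x) \<noteq> last (\<phi> y)) \<and>
     (\<forall>x ys u v. ext \<phi> ys @ p = u @ (\<phi> x @ p) @ v \<longrightarrow>
        (\<exists>m < length ys. u = ext \<phi> (take m ys) \<and> \<phi> x @ p = \<phi> (ys ! m) @ p))"

definition special_P_morphism :: "('a \<Rightarrow> 'a list) \<Rightarrow> bool" where
  "special_P_morphism \<psi> \<longleftrightarrow>
     (\<exists>p q \<phi> p' p''. special_standard_P_morphism p q \<phi> \<and> p = p' @ p'' \<and>
        (\<forall>x. sandwich p'' (q x) p' (\<psi> x)))"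

end

theory Submission
  imports Defs
begin

text \<open>Appending a letter creates at most one new palindromic factor, necessarily a suffix, so the
  defect stays constant exactly when the extended word has a palindromic suffix that did not occur
  before. An infinite word is thus almost rich iff almost every prefix ends with a new palindrome,
  and over a finite alphabet the lengths of these palindromes tend to infinity. Writing
  \<open>\<psi>(x) = p'' q\<^sub>x p'\<close> and \<open>p = p' p''\<close> one has \<open>\<phi>(w) p = p' \<psi>(w) p''\<close>, so the defects
  of \<open>\<psi>(w)\<close> and of \<open>\<phi>(w) p\<close> differ by at most \<open>|p|\<close>. The map \<open>w \<mapsto> \<phi>(w) p\<close> commutes with
  reversal. If \<open>z v z\<close> is a new palindrome at the end of \<open>w z\<close> and \<open>v\<close> is nonempty, then
  synchronization makes the central factors of \<open>\<phi>(z v z) p\<close> containing \<open>\<phi>(v) p\<close> new at each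
  letter between \<open>\<phi>(w) p\<close> and \<open>\<phi>(w z) p\<close>. Conversely, a new palindromic suffix of \<open>\<phi>(w) p\<close> that
  is long enough to contain the last block begins, being a palindrome, with that same block, hence
  equals \<open>\<phi>(v) p\<close> for a new palindromic suffix \<open>v\<close> of \<open>w\<close>.\<close>

section \<open>Defect\<close>

lemma finite_PAL: "finite (PAL w)"
proof (rule finite_subset)
  show "PAL w \<subseteq> set (sublists w)" by (auto simp: PAL_def)
qed simp

lemma PAL_mono: "sublist v w \<Longrightarrow> PAL v \<subseteq> PAL w"
  unfolding PAL_def by (auto intro: sublist_order.order_trans)

lemma PAL_rev: "PAL (rev w) = PAL w"
  unfolding PAL_def palindrome_def by (metis sublist_rev_right)

lemma defect_rev: "defect (rev w) = defect w"
  by (simp add: defect_def PAL_rev)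

lemma sublist_snoc_iff: "sublist v (w @ [a]) \<longleftrightarrow> sublist v w \<or> suffix v (w @ [a])"
proof
  assume "sublist v (w @ [a])"
  then obtain x y where xy: "w @ [a] = x @ v @ y" by (auto simp: sublist_def)
  show "sublist v w \<or> suffix v (w @ [a])"
  proof (cases y rule: rev_cases)
    case Nil
    with xy show ?thesis by (auto simp: suffix_def)
  next
    case (snoc y' b)
    with xy have "w = x @ v @ y'" by (metis append.assoc butlast_snoc)
    then show ?thesis by (auto simp: sublist_def)
  qed
qed (auto intro: suffix_imp_sublist sublist_order.order_trans[OF _ sublist_append_rightI])

definition new_palindrome :: "'a list \<Rightarrow> 'a list \<Rightarrow> 'a \<Rightarrow> bool" where
  "new_palindrome v w a \<longleftrightarrow> palindrome v \<and> suffix v (w @ [a]) \<and> \<not> sublist v w"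

lemma PAL_snoc: "PAL (w @ [a]) = PAL w \<union> {v. new_palindrome v w a}"
  by (auto simp: PAL_def new_palindrome_def sublist_snoc_iff)

text \<open>As a suffix of the palindrome \<open>v\<close>, the palindrome \<open>u\<close> is also
  a prefix of \<open>v\<close>; being shorter, this copy ends before the final letter
  \<open>a\<close>.\<close>

lemma shorter_palindromic_suffix_not_new:
  assumes "palindrome u" "palindrome v" "suffix u (w @ [a])" "suffix v (w @ [a])"
    and "length u < length v"
  shows "sublist u w"
proof -
  have "suffix u v" using assms suffix_length_suffix[of u "w @ [a]" v] by simp
  then have "prefix u v" using assms by (metis palindrome_def suffix_to_prefix)
  then obtain y where y: "v = u @ y" "y \<noteq> []" using assms(5) by (auto simp: prefix_def)
  obtain x where "w @ [a] = x @ v" using assms(4) by (auto simp: suffix_def)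
  with y have "w = x @ u @ butlast y"
    by (metis append.assoc butlast_append butlast_snoc append_is_Nil_conv)
  then show ?thesis by (auto simp: sublist_def)
qed

lemma new_palindrome_unique:
  assumes "new_palindrome u w a" "new_palindrome v w a"
  shows "u = v"
proof -
  have "length u = length v"
    using assms shorter_palindromic_suffix_not_new[of u v w a]
      shorter_palindromic_suffix_not_new[of v u w a]
    unfolding new_palindrome_def by (metis nat_neq_iff)
  with assms show ?thesis
    unfolding new_palindrome_def suffix_def by (metis append_eq_append_conv)
qed

lemma defect_snoc:
  "defect (w @ [a]) = (if \<exists>v. new_palindrome v w a then defect w else defect w + 1)"
proof (cases "\<exists>v. new_palindrome v w a")
  case True
  then obtain v where v: "new_palindrome v w a" by blast
  then have "PAL (w @ [a]) = insert v (PAL w)"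
    using new_palindrome_unique by (auto simp: PAL_snoc)
  moreover have "v \<notin> PAL w" using v by (auto simp: PAL_def new_palindrome_def)
  ultimately show ?thesis using True by (simp add: defect_def finite_PAL)
next
  case False
  then show ?thesis by (simp add: defect_def PAL_snoc)
qed

lemma defect_append_right: "defect w \<le> defect (w @ v)"
proof (induction v rule: rev_induct)
  case (snoc a v)
  then show ?case using defect_snoc[of "w @ v" a] by (simp split: if_splits)
qed simp

lemma defect_append_left: "defect w \<le> defect (v @ w)"
  using defect_append_right[of "rev w" "rev v"] by (metis defect_rev rev_append)

lemma defect_sublist_mono: "sublist v w \<Longrightarrow> defect v \<le> defect w"
  unfolding sublist_def using defect_append_left defect_append_right by (metis order_trans)

lemma defect_extension_le:
  "defect (u @ w @ v) \<le> defect w + int (length u) + int (length v)"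
proof -
  have "card (PAL w) \<le> card (PAL (u @ w @ v))"
    by (intro card_mono finite_PAL PAL_mono) (auto simp: sublist_def)
  then show ?thesis by (simp add: defect_def)
qed

section \<open>Almost richness along prefixes\<close>

lemma almost_rich_iff_prefixes: "almost_rich s \<longleftrightarrow> (\<exists>B. \<forall>n. defect (stake n s) \<le> B)"
proof
  assume "almost_rich s"
  moreover have "stake n s \<in> factors s" for n
    unfolding factors_def by (metis (mono_tags, lifting) mem_Collect_eq sdrop.simps(1))
  ultimately show "\<exists>B. \<forall>n. defect (stake n s) \<le> B" by (auto simp: almost_rich_def)
next
  assume "\<exists>B. \<forall>n. defect (stake n s) \<le> B"
  then obtain B where B: "\<And>n. defect (stake n s) \<le> B" by blast
  have "defect (stake n (sdrop i s)) \<le> B" for i n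
    using defect_append_left[of "stake n (sdrop i s)" "stake i s"] B[of "i + n"]
    by (simp add: stake_add)
  then show "almost_rich s" by (auto simp: almost_rich_def factors_def)
qed

lemma bounded_mono_int_eventually_const:
  fixes f :: "nat \<Rightarrow> int"
  assumes "mono f" and "\<And>n. f n \<le> B"
  shows "\<exists>N. \<forall>n\<ge>N. f n = f N"
proof -
  \<comment> \<open>\<open>N\<close> minimizes the gap to \<open>B\<close>. All gaps are
    nonnegative, so \<open>nat\<close> loses nothing and \<open>f N\<close> is the largest value of
    \<open>f\<close>.\<close>
  obtain N where N: "\<And>n. nat (B - f N) \<le> nat (B - f n)"
    using ex_has_least_nat[of "\<lambda>_. True" 0 "\<lambda>n. nat (B - f n)"] by auto
  have "f n = f N" if "n \<ge> N" for n
    using N[of n] assms(2)[of n] assms(2)[of N] monoD[OF assms(1) that] by linarith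
  then show ?thesis by blast
qed

text \<open>A word that is fresh at step \<open>k\<close> is a factor at every later step, so
  \<open>P\<close> is injective from \<open>N\<close> on; a finite alphabet has only finitely many
  words of length at most \<open>L\<close>.\<close>

lemma fresh_suffixes_eventually_long:
  fixes W P :: "nat \<Rightarrow> 'a::finite list"
  assumes W: "\<And>k. prefix (W k) (W (Suc k))"
    and P: "\<And>k. k \<ge> N \<Longrightarrow> sublist (P k) (W (Suc k)) \<and> \<not> sublist (P k) (W k)"
  shows "\<exists>K\<ge>N. \<forall>k\<ge>K. length (P k) > L"
proof -
  have mono: "prefix (W i) (W j)" if "i \<le> j" for i j
    using that by (induction rule: dec_induct) (auto intro: W prefix_order.order_trans)
  have less: "P i \<noteq> P j" if "N \<le> i" "i < j" for i j
  proof -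
    have "sublist (P i) (W j)"
      using P[of i] mono[of "Suc i" j] that
      by (meson prefix_imp_sublist sublist_order.order_trans Suc_leI)
    then show ?thesis using P[of j] that by auto
  qed
  have "inj_on P {N..}"
    by (rule inj_onI) (metis atLeast_iff less nat_neq_iff)
  moreover have "finite {v :: 'a list. length v \<le> L}"
    using finite_lists_length_le[of "UNIV :: 'a set" L] by simp
  ultimately have "finite (P -` {v. length v \<le> L} \<inter> {N..})"
    by (intro finite_vimage_IntI)
  then obtain K where K: "\<And>k. k \<in> P -` {v. length v \<le> L} \<inter> {N..} \<Longrightarrow> k < K"
    by (meson finite_nat_set_iff_bounded)
  have "length (P k) > L" if "k \<ge> max K N" for k
    using K[of k] that by fastforce
  then show ?thesis by (meson max.cobounded2)
qed

section \<open>Special standard P-morphisms\<close>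

lemma ext_simps [simp]:
  "ext f [] = []" "ext f (x # xs) = f x @ ext f xs" "ext f (xs @ ys) = ext f xs @ ext f ys"
  by (simp_all add: ext_def)

locale special_standard =
  fixes p :: "'a list" and q :: "'a \<Rightarrow> 'a tail" and \<phi> :: "'a \<Rightarrow> 'a list"
  assumes special: "special_standard_P_morphism p q \<phi>"
begin

lemma p_palindrome: "rev p = p"
  using special
  by (simp add: special_standard_P_morphism_def standard_P_morphism_def palindrome_def)

lemma tail: "admissible_tail p (q x)" "sandwich p (q x) [] (\<phi> x)"
  using special by (simp_all add: special_standard_P_morphism_def standard_P_morphism_def)

lemma image_nonempty [simp]: "\<phi> x \<noteq> []"
  using special by (simp add: special_standard_P_morphism_def)

lemma last_image_inject: "last (\<phi> x) = last (\<phi> y) \<longleftrightarrow> x = y"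
  using special unfolding special_standard_P_morphism_def by blast

lemma image_inject: "\<phi> x = \<phi> y \<longleftrightarrow> x = y"
  using last_image_inject by metis

lemma synchronized_letter:
  assumes "ext \<phi> ys @ p = u @ \<phi> x @ p @ v"
  obtains y1 y2 where "ys = y1 @ x # y2" "u = ext \<phi> y1"
proof -
  obtain m where m: "m < length ys" "u = ext \<phi> (take m ys)" "\<phi> x @ p = \<phi> (ys ! m) @ p"
    using special assms unfolding special_standard_P_morphism_def
    by (metis append.assoc)
  then have "ys = take m ys @ x # drop (Suc m) ys"
    by (metis append_same_eq id_take_nth_drop image_inject)
  with m that show thesis by blast
qed

lemma ext_eq_Nil [simp]: "ext \<phi> w = [] \<longleftrightarrow> w = []"
  by (cases w) auto

lemma last_ext: "w \<noteq> [] \<Longrightarrow> last (ext \<phi> w) = last (\<phi> (last w))"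
  by (cases w rule: rev_cases) auto

text \<open>The images have pairwise different last letters, so \<open>ext \<phi> w\<close> can be
  decoded from right to left.\<close>

lemma ext_inject: "ext \<phi> v = ext \<phi> w \<longleftrightarrow> v = w"
proof
  show "ext \<phi> v = ext \<phi> w \<Longrightarrow> v = w"
  proof (induction v arbitrary: w rule: rev_induct)
    case Nil
    then show ?case by (metis ext_eq_Nil)
  next
    case (snoc x v)
    then have "w \<noteq> []" by auto
    then obtain w' y where w: "w = w' @ [y]" by (metis rev_exhaust)
    have "last (\<phi> x) = last (\<phi> y)" using snoc.prems w last_ext
      by (metis ext_eq_Nil last_snoc snoc_eq_iff_butlast)
    then have "x = y" by (simp add: last_image_inject)
    with snoc w show ?case by simp
  qed
qed simp

text \<open>This expresses that \<open>\<phi> x @ p\<close> is a palindrome. In the case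
  \<open>Neg \<pi>\<close> one has \<open>p = \<phi> x @ \<pi> = \<pi> @ rev (\<phi> x)\<close>, and
  both sides equal \<open>\<phi> x @ \<pi> @ rev (\<phi> x)\<close>.\<close>

lemma image_append_p_palindrome: "p @ rev (\<phi> x) = \<phi> x @ p"
proof (cases "q x")
  case (Pos q')
  then have "rev q' = q'" "\<phi> x = p @ q'" using tail[of x] by (auto simp: palindrome_def)
  then show ?thesis by (simp add: p_palindrome)
next
  case (Neg \<pi>)
  then have "rev \<pi> = \<pi>" and p: "p = \<phi> x @ \<pi>"
    using tail[of x] by (auto simp: palindrome_def)
  then have "p = \<pi> @ rev (\<phi> x)" by (metis p_palindrome rev_append)
  with p show ?thesis by (metis append.assoc)
qed

lemma rev_ext_append_p: "rev (ext \<phi> w @ p) = ext \<phi> (rev w) @ p"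
proof (induction w)
  case (Cons x w)
  have "rev (ext \<phi> (x # w) @ p) = rev (ext \<phi> w @ p) @ rev (\<phi> x)" by simp
  also have "\<dots> = ext \<phi> (rev w) @ p @ rev (\<phi> x)" by (simp add: Cons.IH del: rev_append)
  finally show ?case by (simp add: image_append_p_palindrome)
qed (simp add: p_palindrome)

lemma palindrome_ext_append_p: "palindrome (ext \<phi> w @ p) \<longleftrightarrow> palindrome w"
  unfolding palindrome_def rev_ext_append_p by (simp add: ext_inject)

text \<open>Moving \<open>p\<close> to the front shows that appending \<open>w\<close> to a word
  extends its image with \<open>p\<close> on the right by the reversed blocks of
  \<open>w\<close>.\<close>

lemma ext_append_p: "ext \<phi> w @ p = p @ rev (ext \<phi> (rev w))"
  using rev_ext_append_p[of "rev w"] by (simp add: p_palindrome)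

text \<open>The last letter of \<open>w\<close> is located by \<open>synchronized_letter\<close>;
  the letters before it are then read backwards from the last letters of their images.\<close>

lemma synchronized:
  assumes "ext \<phi> ys @ p = u @ ext \<phi> w @ p @ v" and "w \<noteq> []"
  obtains y1 y2 where "ys = y1 @ w @ y2" "u = ext \<phi> y1" "ext \<phi> y2 @ p = p @ v"
proof -
  have "\<exists>y1 y2. ys = y1 @ w @ y2 \<and> u = ext \<phi> y1"
    using assms(2,1)
  proof (induction w arbitrary: u rule: list_nonempty_induct)
    case (single x)
    then have "ext \<phi> ys @ p = u @ \<phi> x @ p @ v" by simp
    then show ?case by (elim synchronized_letter) auto
  next
    case (cons x w)
    have "ext \<phi> ys @ p = (u @ \<phi> x) @ ext \<phi> w @ p @ v" using cons.prems by simp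
    from cons.IH[OF this] obtain y1 y2 where y: "ys = y1 @ w @ y2" "u @ \<phi> x = ext \<phi> y1"
      by blast
    then have ne: "y1 \<noteq> []" by auto
    have "last (\<phi> (last y1)) = last (\<phi> x)"
      using y(2) last_ext[OF ne] by (metis image_nonempty last_appendR)
    then have "y1 = butlast y1 @ [x]" using ne by (metis append_butlast_last_id last_image_inject)
    moreover from this have "u = ext \<phi> (butlast y1)"
      using y(2) by (metis append_same_eq ext_simps(1,2,3) append_Nil2)
    ultimately show ?case using y(1)
      by (metis append.assoc append_Cons append_Nil)
  qed
  then obtain y1 y2 where "ys = y1 @ w @ y2" "u = ext \<phi> y1" by blast
  with assms(1) that show thesis by auto
qed

text \<open>Passing from \<open>w\<close> to \<open>w @ [z]\<close> appends
  \<open>rev (\<phi> z)\<close> to \<open>ext \<phi> w @ p\<close>. After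
  \<open>\<beta> @ [c]\<close> the palindrome is \<open>ext \<phi> v @ p\<close> extended by equally
  many letters on both sides. An earlier occurrence would locate \<open>v\<close> in
  \<open>w @ [z]\<close>, and the extending letters would identify both neighbours of
  \<open>v\<close> as \<open>z\<close>.\<close>

lemma new_palindrome_image:
  assumes new: "new_palindrome (z # v @ [z]) w z" and "v \<noteq> []"
    and \<beta>: "rev (\<phi> z) = \<beta> @ c # \<gamma>"
  shows "new_palindrome (rev (\<beta> @ [c]) @ ext \<phi> v @ p @ \<beta> @ [c]) (ext \<phi> w @ p @ \<beta>) c"
proof -
  have v: "palindrome v" using new by (simp add: new_palindrome_def palindrome_def)
  obtain w' where w': "w = w' @ z # v"
    using new by (auto simp: new_palindrome_def suffix_def)
  have z: "\<phi> z = rev \<gamma> @ rev (\<beta> @ [c])" using \<beta> by (simp add: rev_swap)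
  have last_z: "last (\<phi> z) = hd (\<beta> @ [c])" by (cases \<beta>) (simp_all add: z)
  have pal: "rev (ext \<phi> v @ p) = ext \<phi> v @ p"
    using v palindrome_ext_append_p[of v] by (simp add: palindrome_def)
  have "palindrome (rev (\<beta> @ [c]) @ (ext \<phi> v @ p) @ \<beta> @ [c])"
    unfolding palindrome_def rev_append[of _ "_ @ _ @ _"] rev_append[of "ext \<phi> v @ p"] pal by simp
  moreover have "suffix (rev (\<beta> @ [c]) @ ext \<phi> v @ p @ \<beta> @ [c]) ((ext \<phi> w @ p @ \<beta>) @ [c])"
    unfolding suffix_def w' by (rule exI[of _ "ext \<phi> w' @ rev \<gamma>"]) (simp add: z)
  moreover have "\<not> sublist (rev (\<beta> @ [c]) @ ext \<phi> v @ p @ \<beta> @ [c]) (ext \<phi> w @ p @ \<beta>)"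
  proof
    assume "sublist (rev (\<beta> @ [c]) @ ext \<phi> v @ p @ \<beta> @ [c]) (ext \<phi> w @ p @ \<beta>)"
    then obtain u u' where "ext \<phi> w @ p @ \<beta> = u @ (rev (\<beta> @ [c]) @ ext \<phi> v @ p @ \<beta> @ [c]) @ u'"
      unfolding sublist_def by blast
    \<comment> \<open>Completing the last block makes the left side the full word
      \<open>ext \<phi> (w @ [z]) @ p\<close>, to which synchronization applies.\<close>
    then have "(ext \<phi> w @ p @ \<beta>) @ c # \<gamma> = (u @ (rev (\<beta> @ [c]) @ ext \<phi> v @ p @ \<beta> @ [c]) @ u') @ c # \<gamma>"
      by simp
    moreover have "ext \<phi> (w @ [z]) @ p = (ext \<phi> w @ p @ \<beta>) @ c # \<gamma>"
      using image_append_p_palindrome[of z] \<beta> by simp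
    ultimately have "ext \<phi> (w @ [z]) @ p =
        (u @ rev (\<beta> @ [c])) @ ext \<phi> v @ p @ (\<beta> @ [c]) @ u' @ c # \<gamma>" by simp
    then obtain y1 y2 where y: "w @ [z] = y1 @ v @ y2" "u @ rev (\<beta> @ [c]) = ext \<phi> y1"
      "ext \<phi> y2 @ p = p @ (\<beta> @ [c]) @ u' @ c # \<gamma>"
      using \<open>v \<noteq> []\<close> by (elim synchronized) auto
    \<comment> \<open>Left neighbour: \<open>rev (\<beta> @ [c])\<close> ends with the last letter
      of \<open>\<phi> z\<close>.\<close>
    have "y1 \<noteq> []" using y(2) by auto
    moreover have "last (\<phi> (last y1)) = last (\<phi> z)"
      using y(2) last_ext[OF \<open>y1 \<noteq> []\<close>] z by (metis last_appendR rev_is_Nil_conv snoc_eq_iff_butlast)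
    ultimately obtain y1' where y1: "y1 = y1' @ [z]"
      by (metis append_butlast_last_id last_image_inject)
    \<comment> \<open>Right neighbour: the reversed blocks of \<open>y2\<close> follow
      \<open>p\<close>, and their first letter is the last letter of
      \<open>\<phi> (hd y2)\<close>.\<close>
    have R: "rev (ext \<phi> (rev y2)) = (\<beta> @ [c]) @ u' @ c # \<gamma>"
      using y(3) ext_append_p[of y2] by simp
    then have "y2 \<noteq> []" by auto
    have "last (\<phi> (hd y2)) = last (ext \<phi> (rev y2))"
      using \<open>y2 \<noteq> []\<close> by (simp add: last_ext last_rev)
    also have "\<dots> = hd (rev (ext \<phi> (rev y2)))" by (simp add: hd_rev)
    also have "\<dots> = last (\<phi> z)" unfolding R last_z by (simp add: hd_append)
    finally obtain y2' where y2: "y2 = z # y2'"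
      using \<open>y2 \<noteq> []\<close> by (metis last_image_inject list.collapse)
    show False
    \<comment> \<open>An empty \<open>y2'\<close> would be the occurrence at the very end; then
      \<open>rev (\<phi> z)\<close> would have to hold \<open>u'\<close> and a second
      \<open>c\<close> besides its own letters. Otherwise \<open>z v z\<close> already lies in
      \<open>w\<close>.\<close>
    proof (cases y2' rule: rev_cases)
      case Nil
      then have "length (rev (\<phi> z)) = length ((\<beta> @ [c]) @ u' @ c # \<gamma>)"
        using R y2 by (metis append_Nil2 ext_simps(1,2) rev_singleton_conv)
      then show False by (simp add: \<beta>)
    next
      case (snoc y3 b)
      then have "w = y1' @ (z # v @ [z]) @ y3" using y(1) y1 y2 by simp
      then show False using new by (auto simp: new_palindrome_def sublist_def)
    qed
  qed
  ultimately show ?thesis by (simp add: new_palindrome_def)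
qed

lemma defect_image_const:
  assumes new: "new_palindrome (z # v @ [z]) w z" and "v \<noteq> []"
  shows "defect (ext \<phi> (w @ [z]) @ p) = defect (ext \<phi> w @ p)"
proof -
  have "rev (\<phi> z) = \<beta> @ \<delta> \<Longrightarrow> defect (ext \<phi> w @ p @ \<beta>) = defect (ext \<phi> w @ p)" for \<beta> \<delta>
  proof (induction \<beta> arbitrary: \<delta> rule: rev_induct)
    case (snoc c \<beta>)
    then have "rev (\<phi> z) = \<beta> @ c # \<delta>" by simp
    from new_palindrome_image[OF assms this] snoc.IH[OF this] show ?case
      using defect_snoc[of "ext \<phi> w @ p @ \<beta>" c] by auto
  qed simp
  from this[of "rev (\<phi> z)" "[]"] show ?thesis
    by (simp add: image_append_p_palindrome)
qed

text \<open>By its length \<open>P\<close> ends with the palindrome \<open>\<phi> x @ p\<close>, so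
  it also begins with it. Synchronizing this beginning suffices, as \<open>P\<close> extends to the
  end of the whole word and is thus the image, with \<open>p\<close>, of a suffix of
  \<open>w @ [x]\<close>.\<close>

lemma long_new_palindromic_suffix:
  assumes pal: "palindrome P" and suf: "suffix P (ext \<phi> (w @ [x]) @ p)"
    and long: "length P \<ge> length (\<phi> x @ p)"
    and fresh: "\<not> sublist P (ext \<phi> w @ p)"
  shows "\<exists>v. new_palindrome v w x"
proof -
  have "suffix (\<phi> x @ p) (ext \<phi> (w @ [x]) @ p)" by (simp add: suffix_def)
  then have "suffix (\<phi> x @ p) P" using suf long suffix_length_suffix by blast
  then have "prefix (rev (\<phi> x @ p)) (rev P)" by (simp add: suffix_to_prefix)
  then have "prefix (\<phi> x @ p) P"
    using pal image_append_p_palindrome[of x] by (simp add: palindrome_def p_palindrome)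
  then obtain r where P: "P = \<phi> x @ p @ r" by (auto simp: prefix_def)
  obtain u where u: "ext \<phi> (w @ [x]) @ p = u @ P" using suf by (auto simp: suffix_def)
  with P obtain y1 y2 where y: "w @ [x] = y1 @ x # y2" "u = ext \<phi> y1"
    by (metis synchronized_letter)
  have P_eq: "P = ext \<phi> (x # y2) @ p" using u y by simp
  moreover from this have "palindrome (x # y2)" using pal palindrome_ext_append_p by metis
  moreover have "\<not> sublist (x # y2) w"
  proof
    assume "sublist (x # y2) w"
    then obtain a b where "w = a @ (x # y2) @ b" by (auto simp: sublist_def)
    then have "ext \<phi> w @ p = ext \<phi> a @ ext \<phi> (x # y2) @ p @ rev (ext \<phi> (rev b))"
      using ext_append_p[of b] by simp
    then show False using fresh P_eq by (auto simp: sublist_def)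
  qed
  ultimately show ?thesis
    unfolding new_palindrome_def using y(1) by (auto simp: suffix_def)
qed

lemma prefix_image_append_p: "prefix (ext \<phi> w @ p) (ext \<phi> (w @ v) @ p)"
  using ext_append_p[of v] by (simp add: prefix_def)

end

section \<open>Bounded defect of a word and of its image\<close>

context
  fixes p :: "'a::finite list" and q \<phi> and t :: "'a stream"
  assumes special: "special_standard_P_morphism p q \<phi>"
begin

interpretation special_standard p q \<phi> by standard (rule special)

lemma defect_image_bounded_if_almost_rich:
  assumes "almost_rich t"
  shows "\<exists>B. \<forall>k. defect (ext \<phi> (stake k t) @ p) \<le> B"
proof -
  define W where "W k = stake k t" for k
  define F where "F k = defect (ext \<phi> (W k) @ p)" for k
  have W_Suc: "W (Suc k) = W k @ [t !! k]" for k by (simp add: W_def stake_Suc del: stake.simps)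
  obtain B where "\<And>k. defect (W k) \<le> B"
    using assms unfolding almost_rich_iff_prefixes W_def by blast
  moreover have "mono (\<lambda>k. defect (W k))"
    by (intro mono_iff_le_Suc[THEN iffD2] allI) (simp add: W_Suc defect_append_right)
  ultimately obtain N where N: "\<And>k. k \<ge> N \<Longrightarrow> defect (W k) = defect (W N)"
    using bounded_mono_int_eventually_const by blast
  have "\<exists>v. new_palindrome v (W k) (t !! k)" if "k \<ge> N" for k
    using N[of k] N[of "Suc k"] that defect_snoc[of "W k" "t !! k"]
    by (auto simp: W_Suc split: if_splits)
  then obtain P where P: "\<And>k. k \<ge> N \<Longrightarrow> new_palindrome (P k) (W k) (t !! k)" by metis
  \<comment> \<open>Length above 2 gives the form \<open>z v z\<close> with \<open>v\<close>
    nonempty, as synchronization requires.\<close>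
  obtain K where K: "K \<ge> N" "\<And>k. k \<ge> K \<Longrightarrow> length (P k) > 2"
    using fresh_suffixes_eventually_long[of W N P 2] P
    by (auto simp: W_Suc new_palindrome_def suffix_imp_sublist)
  have step: "F (Suc k) = F k" if "k \<ge> K" for k
  proof -
    have new: "new_palindrome (P k) (W k) (t !! k)" using P K(1) that by simp
    then have l: "last (P k) = t !! k" "rev (P k) = P k" "P k \<noteq> []"
      using K(2)[OF that] by (auto simp: new_palindrome_def palindrome_def suffix_def) 
        (metis last_appendR last_snoc list.size(3) not_less_zero)
    then have h: "hd (P k) = t !! k" by (metis hd_rev)
    obtain z r where zr: "P k = z # r" using l by (cases "P k") auto
    then have "r \<noteq> []" using K(2)[OF that] by auto
    then obtain v z' where r: "r = v @ [z']" by (metis rev_exhaust)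
    then have "v \<noteq> []" using zr K(2)[OF that] by auto
    moreover have "P k = t !! k # v @ [t !! k]" using zr r l(1) h by simp
    ultimately show ?thesis using new defect_image_const unfolding F_def W_Suc by metis
  qed
  have inc: "mono F"
    unfolding F_def using prefix_image_append_p
    by (intro mono_iff_le_Suc[THEN iffD2] allI) (metis W_Suc defect_sublist_mono prefix_imp_sublist)
  have const: "F k = F K" if "k \<ge> K" for k
    using that by (induction rule: dec_induct) (auto simp: step)
  have "F k \<le> F K" for k using const[of k] monoD[OF inc, of k K] by (cases "k \<ge> K") auto
  then show ?thesis unfolding F_def W_def by blast
qed

lemma almost_rich_if_defect_image_bounded:
  assumes B: "\<And>k. defect (ext \<phi> (stake k t) @ p) \<le> B"
  shows "almost_rich t"
proof -
  define W where "W k = ext \<phi> (stake k t) @ p" for k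
  have W_prefix: "prefix (W k) (W (Suc k))" for k
    unfolding W_def stake_Suc by (rule prefix_image_append_p)
  have inc: "mono (\<lambda>k. defect (W k))"
    by (intro mono_iff_le_Suc[THEN iffD2] allI defect_sublist_mono prefix_imp_sublist W_prefix)
  then obtain N where N: "\<And>k. k \<ge> N \<Longrightarrow> defect (W k) = defect (W N)"
    using bounded_mono_int_eventually_const[of "\<lambda>k. defect (W k)" B] B
    unfolding W_def by blast
  have "\<exists>v. palindrome v \<and> suffix v (W (Suc k)) \<and> \<not> sublist v (W k)" if "k \<ge> N" for k
  proof -
    obtain r where r: "W (Suc k) = W k @ r" using W_prefix by (auto simp: prefix_def)
    moreover have "r \<noteq> []"
    proof
      assume "r = []"
      with r have "length (W (Suc k)) = length (W k)" by simp
      then show False by (simp add: W_def stake_Suc del: stake.simps)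
    qed
    ultimately obtain r' c where W: "W (Suc k) = (W k @ r') @ [c]" by (metis append.assoc rev_exhaust)
    \<comment> \<open>The defect is squeezed between equal values at \<open>W k\<close> and
      \<open>W (Suc k)\<close>, so the last letter \<open>c\<close> must bring a palindrome absent
      from \<open>W k @ r'\<close>, hence from \<open>W k\<close>.\<close>
    have "defect (W k @ r') = defect ((W k @ r') @ [c])"
      using defect_append_right[of "W k" r'] defect_append_right[of "W k @ r'" "[c]"]
        N[of k] N[of "Suc k"] that W by simp
    then obtain v where "new_palindrome v (W k @ r') c"
      using defect_snoc[of "W k @ r'" c] by (auto split: if_splits)
    then show ?thesis unfolding W new_palindrome_def
      by (meson sublist_append_rightI sublist_order.order_trans)
  qed
  then obtain P where P: "\<And>k. k \<ge> N \<Longrightarrow>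
      palindrome (P k) \<and> suffix (P k) (W (Suc k)) \<and> \<not> sublist (P k) (W k)" by metis
  \<comment> \<open>Finiteness of the alphabet bounds all blocks at once, so that a palindrome
    longer than \<open>L\<close> covers the last block together with \<open>p\<close>.\<close>
  define L where "L = Max (range (\<lambda>x. length (\<phi> x @ p)))"
  have L: "length (\<phi> x @ p) \<le> L" for x unfolding L_def by (rule Max_ge) auto
  obtain K where K: "K \<ge> N" "\<And>k. k \<ge> K \<Longrightarrow> length (P k) > L"
    using fresh_suffixes_eventually_long[of W N P L] P W_prefix
    by (auto simp: suffix_imp_sublist)
  have step: "defect (stake (Suc k) t) = defect (stake k t)" if "k \<ge> K" for k
  proof -
    have "\<exists>v. new_palindrome v (stake k t) (t !! k)"
    proof (rule long_new_palindromic_suffix)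
      show "length (\<phi> (t !! k) @ p) \<le> length (P k)"
        using K(2)[OF that] L[of "t !! k"] by linarith
    qed (use P[of k] K(1) that in \<open>auto simp: W_def stake_Suc simp del: stake.simps\<close>)
    then show ?thesis unfolding stake_Suc defect_snoc by simp
  qed
  have const: "defect (stake k t) = defect (stake K t)" if "k \<ge> K" for k
    using that by (induction rule: dec_induct) (auto simp: step simp del: stake.simps)
  have inc_t: "mono (\<lambda>k. defect (stake k t))"
    by (intro mono_iff_le_Suc[THEN iffD2] allI)
      (simp add: stake_Suc defect_append_right del: stake.simps)
  have "defect (stake k t) \<le> defect (stake K t)" for k
    using const[of k] monoD[OF inc_t, of k K] by (cases "k \<ge> K") auto
  then show ?thesis unfolding almost_rich_iff_prefixes by blast
qed

end

section \<open>Conjugation\<close>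

text \<open>In the free group both sides are \<open>p' p'' q p'\<close> with \<open>q\<close> the
  value of \<open>q x\<close>. For \<open>Neg \<pi>\<close>, the image \<open>\<phi> x\<close> is
  \<open>p\<close> without its suffix \<open>\<pi>\<close>, whereas \<open>\<psi> x\<close> may
  cancel \<open>\<pi>\<close> partly on each side; removing the common suffix \<open>\<pi>2\<close>
  reconciles the two.\<close>

lemma (in special_standard) conjugate_image:
  assumes p: "p = p' @ p''" and \<psi>: "sandwich p'' (q x) p' (\<psi> x)"
  shows "p' @ \<psi> x = \<phi> x @ p'"
proof (cases "q x")
  case (Pos r)
  then show ?thesis using \<psi> tail(2)[of x] p by simp
next
  case (Neg \<pi>)
  then obtain \<pi>1 \<pi>2 u v where eqs: "\<pi> = \<pi>1 @ \<pi>2" "p'' = u @ \<pi>2" "p' = \<pi>1 @ v" "\<psi> x = u @ v"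
    using \<psi> by auto
  have "p = \<phi> x @ \<pi>" using Neg tail(2)[of x] by auto
  then have "(p' @ u) @ \<pi>2 = (\<phi> x @ \<pi>1) @ \<pi>2" using p eqs(1,2) by simp
  then have "p' @ u = \<phi> x @ \<pi>1" by (simp only: append_same_eq)
  then have "(p' @ u) @ v = (\<phi> x @ \<pi>1) @ v" by (rule arg_cong)
  then show ?thesis using eqs(3,4) by simp
qed

lemma conjugate_ext:
  assumes "\<And>x. r @ \<psi> x = \<phi> x @ r"
  shows "r @ ext \<psi> w = ext \<phi> w @ r"
proof (induction w)
  case (Cons x w)
  have "r @ ext \<psi> (x # w) = (\<phi> x @ r) @ ext \<psi> w" by (simp flip: assms)
  then show ?case by (simp add: Cons.IH)
qed simp

section \<open>Images of infinite words\<close>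

lemma ext_inf_unfold:
  fixes f :: "'a \<Rightarrow> 'b list"
  assumes "\<And>x. f x \<noteq> []"
  shows "ext_inf f t = ext f (stake k t) @- ext_inf f (sdrop k t)"
proof (induction k arbitrary: t)
  case (Suc k)
  have "ext_inf f t = f (shd t) @- ext_inf f (stl t)"
    unfolding ext_inf_def by (metis assms flat_unfold stream.map_sel)
  then show ?case using Suc[of "stl t"] by simp
qed simp

text \<open>The images of prefixes of \<open>t\<close> are arbitrarily long prefixes of
  \<open>ext_inf f t\<close>, and the defect is monotone, so bounding it along them is
  enough.\<close>

lemma almost_rich_ext_inf_iff:
  assumes "\<And>x. f x \<noteq> []"
  shows "almost_rich (ext_inf f t) \<longleftrightarrow> (\<exists>B. \<forall>k. defect (ext f (stake k t)) \<le> B)"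
proof -
  have eq: "stake (length (ext f (stake k t))) (ext_inf f t) = ext f (stake k t)" for k
    by (subst ext_inf_unfold[OF assms, where t = t and k = k]) (simp add: stake_shift)
  have long: "length (ext f w) \<ge> length w" for w
  proof (induction w)
    case (Cons x w)
    then show ?case using assms[of x] by (cases "f x") auto
  qed simp
  have "prefix (stake n (ext_inf f t)) (ext f (stake n t))" for n
  proof -
    have "stake n (ext_inf f t) = take n (ext f (stake n t))"
      using eq[of n] long[of "stake n t"] by (metis length_stake min.absorb2 take_stake min.commute)
    then show ?thesis by (simp add: take_is_prefix)
  qed
  then show ?thesis unfolding almost_rich_iff_prefixes
    by (metis eq defect_sublist_mono order_trans prefix_imp_sublist)
qed

theorem theorem6p24:
  fixes \<sigma> :: "'a::finite \<Rightarrow> 'a list" and s t :: "'a stream"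
  assumes "special_P_morphism \<sigma>"
    and "s = ext_inf \<sigma> t"
  shows "almost_rich s \<longleftrightarrow> almost_rich t"
proof -
  obtain p q \<phi> p' p'' where special: "special_standard_P_morphism p q \<phi>"
    and p: "p = p' @ p''" and \<sigma>: "\<And>x. sandwich p'' (q x) p' (\<sigma> x)"
    using assms(1) unfolding special_P_morphism_def by blast
  interpret special_standard p q \<phi> by standard (rule special)
  have conj: "p' @ \<sigma> x = \<phi> x @ p'" for x using conjugate_image[OF p \<sigma>] .
  \<comment> \<open>An empty \<open>\<sigma> x\<close> would give \<open>p' = \<phi> x @ p'\<close>
    and hence an empty \<open>\<phi> x\<close>.\<close>
  have "\<sigma> x \<noteq> []" for x
    using conj[of x] image_nonempty[of x] by (metis append_Nil2 append_self_conv2)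
  then have s: "almost_rich s \<longleftrightarrow> (\<exists>B. \<forall>k. defect (ext \<sigma> (stake k t)) \<le> B)"
    unfolding assms(2) by (rule almost_rich_ext_inf_iff)
  have eq: "ext \<phi> w @ p = p' @ ext \<sigma> w @ p''" for w
    using conjugate_ext[of p' \<sigma> \<phi> w, OF conj] by (simp add: p)
  have up: "defect (ext \<phi> w @ p) \<le> defect (ext \<sigma> w) + int (length p)" for w
    using defect_extension_le[of p' "ext \<sigma> w" p''] unfolding eq by (simp add: p)
  have low: "defect (ext \<sigma> w) \<le> defect (ext \<phi> w @ p)" for w
    unfolding eq by (rule defect_sublist_mono) (auto simp: sublist_def)
  show ?thesis
  proof
    assume "almost_rich s"
    then obtain B where "\<And>k. defect (ext \<sigma> (stake k t)) \<le> B" using s by blast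
    then have "defect (ext \<phi> (stake k t) @ p) \<le> B + int (length p)" for k
      using up[of "stake k t"] by (meson add_right_mono order_trans)
    then show "almost_rich t" by (rule almost_rich_if_defect_image_bounded[OF special])
  next
    assume "almost_rich t"
    then show "almost_rich s"
      using defect_image_bounded_if_almost_rich[OF special] s low by (meson order_trans)
  qed
qed

end
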